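(* Let $A$ be a finite set and let $X \subset A^{\mathbb{Z}}$ be a subshift of finite type. Suppose that $X$ contains an infinite irreducible component. Then the subshift $X$ is not injunctive.
   Context: $A^{\mathbb{Z}}$ carries the product topology ($A$ discrete) and the shift homeomorphism $\sigma$, $(\sigma(x))_i = x_{i+1}$. A subshift is a closed subset $X\subset A^{\mathbb{Z}}$ with $\sigma(X)=X$. It is of finite type if there are an integer $n\ge 0$ and $S\subset A^n$ such that $X$ is the set of all $x\in A^{\mathbb{Z}}$ with $(x_{i+1},\dots,x_{i+n})\in S$ for all $i\in\mathbb{Z}$. An endomorphism of $X$ is a continuous map $\tau\colon X\to X$ commuting with $\sigma$. $X$ is injunctive if every surjective endomorphism of $X$ is injective. $\mathrm{NW}(X)$ is the set of $x\in X$ such that for every neighborhood $U$ of $x$ in $X$ there is $n\ge1$ with $U\cap\sigma^n(U)\neq\varnothing$. A subshift $Y$ is irreducible if it is non-empty and for all non-empty open $U,W\subset Y$ there is $n\ge 1$ with $U\cap\sigma^n(W)\ne\varnothing$. For a subshift of finite type $X$, there is a unique finite partition of $\mathrm{NW}(X)$ into irreducible subshifts; its elements are the irreducible components of $X$. *)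

theory Defs
  imports "HOL-Analysis.Analysis" "HOL-Library.Disjoint_Sets"
begin

definition full_shift :: "'a set \<Rightarrow> (int \<Rightarrow> 'a) topology" where
  "full_shift A = product_topology (\<lambda>_. discrete_topology A) UNIV"

definition shift_map :: "(int \<Rightarrow> 'a) \<Rightarrow> (int \<Rightarrow> 'a)" where
  "shift_map x = (\<lambda>i. x (i + 1))"

definition subshift :: "'a set \<Rightarrow> (int \<Rightarrow> 'a) set \<Rightarrow> bool" where
  "subshift A X \<longleftrightarrow> closedin (full_shift A) X \<and> shift_map ` X = X"

text \<open>\<open>A\<^sup>n\<close> is rendered as the set of lists of length \<open>n\<close> over \<open>A\<close>, so that
  \<open>map (\<lambda>k. x (i + int k)) [1..<n+1]\<close> is the word \<open>(x\<^sub>i\<^sub>+\<^sub>1, \<dots>, x\<^sub>i\<^sub>+\<^sub>n)\<close>.\<close>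

definition subshift_of_finite_type :: "'a set \<Rightarrow> (int \<Rightarrow> 'a) set \<Rightarrow> bool" where
  "subshift_of_finite_type A X \<longleftrightarrow> subshift A X \<and>
     (\<exists>n S. S \<subseteq> {w. length w = n \<and> set w \<subseteq> A} \<and>
        X = {x \<in> topspace (full_shift A). \<forall>i. map (\<lambda>k. x (i + int k)) [1..<n+1] \<in> S})"

definition endomorphism :: "'a set \<Rightarrow> (int \<Rightarrow> 'a) set \<Rightarrow> ((int \<Rightarrow> 'a) \<Rightarrow> (int \<Rightarrow> 'a)) \<Rightarrow> bool" where
  "endomorphism A X \<tau> \<longleftrightarrow>
     continuous_map (subtopology (full_shift A) X) (subtopology (full_shift A) X) \<tau> \<and>
     (\<forall>x\<in>X. \<tau> (shift_map x) = shift_map (\<tau> x))"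

definition injunctive :: "'a set \<Rightarrow> (int \<Rightarrow> 'a) set \<Rightarrow> bool" where
  "injunctive A X \<longleftrightarrow> (\<forall>\<tau>. endomorphism A X \<tau> \<and> \<tau> ` X = X \<longrightarrow> inj_on \<tau> X)"

definition NW :: "'a set \<Rightarrow> (int \<Rightarrow> 'a) set \<Rightarrow> (int \<Rightarrow> 'a) set" where
  "NW A X = {x \<in> X. \<forall>U. U \<subseteq> X \<and> (\<exists>V. openin (subtopology (full_shift A) X) V \<and> x \<in> V \<and> V \<subseteq> U)
     \<longrightarrow> (\<exists>n\<ge>1. U \<inter> (shift_map ^^ n) ` U \<noteq> {})}"

definition irreducible_subshift :: "'a set \<Rightarrow> (int \<Rightarrow> 'a) set \<Rightarrow> bool" where
  "irreducible_subshift A Y \<longleftrightarrow> subshift A Y \<and> Y \<noteq> {} \<and>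
     (\<forall>U W. openin (subtopology (full_shift A) Y) U \<and> U \<noteq> {} \<and>
            openin (subtopology (full_shift A) Y) W \<and> W \<noteq> {}
        \<longrightarrow> (\<exists>n\<ge>1. U \<inter> (shift_map ^^ n) ` W \<noteq> {}))"

definition irreducible_decomposition ::
    "'a set \<Rightarrow> (int \<Rightarrow> 'a) set \<Rightarrow> (int \<Rightarrow> 'a) set set \<Rightarrow> bool" where
  "irreducible_decomposition A X P \<longleftrightarrow>
     finite P \<and> partition_on (NW A X) P \<and> (\<forall>Y\<in>P. irreducible_subshift A Y)"

text \<open>A decomposition is unique if it exists (\<open>irreducible_decomposition_unique\<close> below), so the
  existential quantifier picks out the elements of the decomposition.\<close>

definition irreducible_component :: "'a set \<Rightarrow> (int \<Rightarrow> 'a) set \<Rightarrow> (int \<Rightarrow> 'a) set \<Rightarrow> bool" where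
  "irreducible_component A X Y \<longleftrightarrow> (\<exists>P. irreducible_decomposition A X P \<and> Y \<in> P)"

lemma irreducible_decomposition_refines:
  assumes P: "irreducible_decomposition A X P" and Q: "irreducible_decomposition A X Q"
    and Y: "Y \<in> P"
  shows "\<exists>Z\<in>Q. Y \<subseteq> Z"
proof -
  have irrY: "irreducible_subshift A Y"
    using P Y by (auto simp: irreducible_decomposition_def)
  have unQ: "\<Union>Q = NW A X" and finQ: "finite Q" and disjQ: "disjoint Q"
    and subQ: "\<And>Z. Z \<in> Q \<Longrightarrow> subshift A Z"
    using Q by (auto simp: irreducible_decomposition_def partition_on_def irreducible_subshift_def)
  have YNW: "Y \<subseteq> \<Union>Q"
    using P Y unQ by (auto simp: irreducible_decomposition_def partition_on_def)
  have Ytop: "Y \<subseteq> topspace (full_shift A)"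
    using irrY closedin_subset by (auto simp: irreducible_subshift_def subshift_def)
  have opn: "openin (subtopology (full_shift A) Y) (Y \<inter> Z)" if Z: "Z \<in> Q" for Z
  proof -
    have "closedin (full_shift A) (\<Union>(Q - {Z}))"
      using finQ subQ by (intro closedin_Union) (auto simp: subshift_def)
    then have "openin (full_shift A) (topspace (full_shift A) - \<Union>(Q - {Z}))"
      by blast
    moreover have "Y \<inter> Z = (topspace (full_shift A) - \<Union>(Q - {Z})) \<inter> Y"
      using YNW Ytop disjQ Z by (fastforce simp: disjoint_def)
    ultimately show ?thesis
      by (auto simp: openin_subtopology)
  qed
  obtain y where y: "y \<in> Y"
    using irrY by (auto simp: irreducible_subshift_def)
  then obtain Z where Z: "Z \<in> Q" "y \<in> Z"
    using YNW by blast
  have "Y \<subseteq> Z"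
  proof
    fix x assume x: "x \<in> Y"
    then obtain Z' where Z': "Z' \<in> Q" "x \<in> Z'"
      using YNW by blast
    have "Y \<inter> Z \<noteq> {}" "Y \<inter> Z' \<noteq> {}"
      using x y Z Z' by auto
    then obtain n where n: "(Y \<inter> Z) \<inter> (shift_map ^^ n) ` (Y \<inter> Z') \<noteq> {}"
      using irrY opn[OF Z(1)] opn[OF Z'(1)] unfolding irreducible_subshift_def by blast
    have "(shift_map ^^ n) ` Z' \<subseteq> Z'"
    proof (induction n)
      case (Suc n)
      then show ?case
        using subQ[OF Z'(1)] by (auto simp: subshift_def)
    qed simp
    then have "Z \<inter> Z' \<noteq> {}"
      using n by blast
    then show "x \<in> Z"
      using disjQ Z Z' by (auto simp: disjoint_def)
  qed
  then show ?thesis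
    using Z by blast
qed

lemma irreducible_decomposition_unique:
  assumes "irreducible_decomposition A X P" and "irreducible_decomposition A X Q"
  shows "P = Q"
proof -
  have "P \<subseteq> Q" if P: "irreducible_decomposition A X P" and Q: "irreducible_decomposition A X Q"
    for P Q
  proof
    fix Y assume Y: "Y \<in> P"
    obtain Z where Z: "Z \<in> Q" "Y \<subseteq> Z"
      using irreducible_decomposition_refines[OF P Q Y] by blast
    obtain Y' where Y': "Y' \<in> P" "Z \<subseteq> Y'"
      using irreducible_decomposition_refines[OF Q P Z(1)] by blast
    have "Y \<noteq> {}" "disjoint P"
      using P Y by (auto simp: irreducible_decomposition_def partition_on_def)
    then have "Y = Y'"
      using Y Y' Z by (metis disjointD inf.orderE subset_trans)
    then show "Y \<in> Q"
      using Z Y' by auto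
  qed
  then show ?thesis
    using assms by blast
qed

end

theory Submission
  imports Defs "HOL-Library.Sublist"
begin

text \<open>An infinite irreducible subshift contains a word \<open>p\<close>, as long as the window of \<open>X\<close>, with two
  different first-return words \<open>a\<close> and \<open>b\<close>: otherwise all its points would have the period
  given by the only one. Occurrences of \<open>p\<close> delimit the factors \<open>a\<close>, \<open>b\<close>, so \<open>P = aap\<close> occurs in
  \<open>U = aababbP\<close> and \<open>V = aabbabP\<close> only at the two ends. Hence occurrences of \<open>U\<close> and \<open>V\<close> in a
  point of \<open>X\<close> overlap at most in \<open>P\<close>, and exchanging \<open>U\<close> and \<open>V\<close> at any set of occurrences
  neither leaves \<open>X\<close> nor creates or destroys occurrences. Reading \<open>U\<close>, \<open>V\<close> as bits, replace each
  bit in a run of consecutive occurrences by its sum mod 2 with the next bit of the run, keeping the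
  last bit. Given the output, the bits can be solved for along every run, so this endomorphism is
  surjective, but it sends the periodic points consisting only of \<open>U\<close> and only of \<open>V\<close> to the
  same point.\<close>

section \<open>Words and cylinders\<close>

definition word :: "(int \<Rightarrow> 'a) \<Rightarrow> int \<Rightarrow> nat \<Rightarrow> 'a list" where
  "word x i l = map (\<lambda>k. x (i + int k)) [0..<l]"

lemma length_word [simp]: "length (word x i l) = l"
  by (simp add: word_def)

lemma nth_word [simp]: "k < l \<Longrightarrow> word x i l ! k = x (i + int k)"
  by (simp add: word_def)

lemma word_eq_iff: "word x i l = w \<longleftrightarrow> length w = l \<and> (\<forall>k<l. x (i + int k) = w ! k)"
  by (auto simp: list_eq_iff_nth_eq)

lemma drop_word: "drop k (word x i l) = word x (i + int k) (l - k)"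
  by (rule nth_equalityI) (auto simp: algebra_simps)

lemma take_word: "k \<le> l \<Longrightarrow> take k (word x i l) = word x i k"
  by (rule nth_equalityI) auto

lemma word_append: "word x i k @ word x (i + int k) l = word x i (k + l)"
  by (rule nth_equalityI) (auto simp: nth_append algebra_simps)

lemma word_shift: "word (\<lambda>t. x (t + j)) i l = word x (i + j) l"
  by (simp add: word_def algebra_simps)

lemma topspace_full_shift: "topspace (full_shift A) = {x. \<forall>i. x i \<in> A}"
  by (auto simp: full_shift_def PiE_UNIV_domain)

lemma openin_cylinder:
  assumes "X \<subseteq> topspace (full_shift A)" and "finite F"
  shows "openin (subtopology (full_shift A) X) {x \<in> X. \<forall>i\<in>F. x i = y i}"
proof -
  let ?U = "\<lambda>i. if i \<in> F then A \<inter> {y i} else A"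
  have "openin (full_shift A) (PiE UNIV ?U)"
    unfolding full_shift_def
    by (rule product_topology_basis) (use assms(2) in \<open>auto intro: finite_subset[of _ F]\<close>)
  moreover have "{x \<in> X. \<forall>i\<in>F. x i = y i} = PiE UNIV ?U \<inter> X"
    using assms(1) by (fastforce simp: topspace_full_shift PiE_UNIV_domain split: if_splits)
  ultimately show ?thesis
    by (auto simp: openin_subtopology)
qed

text \<open>Easy half of the Curtis-Hedlund theorem: continuity is tested on single output
  coordinates, where preimages are unions of cylinders.\<close>

lemma continuous_map_full_shiftI:
  assumes X: "X \<subseteq> topspace (full_shift A)" and f: "f ` X \<subseteq> X"
    and loc: "\<And>t. \<exists>F. finite F \<and> (\<forall>x\<in>X. \<forall>y\<in>X. (\<forall>i\<in>F. x i = y i) \<longrightarrow> f x t = f y t)"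
  shows "continuous_map (subtopology (full_shift A) X) (subtopology (full_shift A) X) f"
proof -
  have top: "topspace (subtopology (full_shift A) X) = X"
    using X by auto
  have "continuous_map (subtopology (full_shift A) X) (discrete_topology A) (\<lambda>x. f x t)" for t
    unfolding continuous_map_def top
  proof (intro conjI allI impI)
    show "(\<lambda>x. f x t) \<in> X \<rightarrow> topspace (discrete_topology A)"
      using X f by (fastforce simp: topspace_full_shift)
    fix U
    obtain F where F: "finite F"
      "\<And>x y. x \<in> X \<Longrightarrow> y \<in> X \<Longrightarrow> \<forall>i\<in>F. x i = y i \<Longrightarrow> f x t = f y t"
      using loc[of t] by blast
    show "openin (subtopology (full_shift A) X) {x \<in> X. f x t \<in> U}"
    proof (subst openin_subopen, intro ballI)
      fix x assume x: "x \<in> {x \<in> X. f x t \<in> U}"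
      have "{y \<in> X. \<forall>i\<in>F. y i = x i} \<subseteq> {x \<in> X. f x t \<in> U}"
        using F(2) x by (smt (verit) mem_Collect_eq subsetI)
      then show "\<exists>T. openin (subtopology (full_shift A) X) T \<and> x \<in> T \<and> T \<subseteq> {x \<in> X. f x t \<in> U}"
        using openin_cylinder[OF X F(1), of x] x by blast
    qed
  qed
  then have "continuous_map (subtopology (full_shift A) X) (full_shift A) f"
    by (simp add: full_shift_def continuous_map_componentwise_UNIV)
  then show ?thesis
    using f top by (auto simp: continuous_map_in_subtopology)
qed

lemma subshift_translate:
  assumes "subshift A Y" and "y \<in> Y"
  shows "(\<lambda>t. y (t + j)) \<in> Y"
proof (induction j rule: int_induct[where k = 0])
  case base
  then show ?case using assms(2) by simp
next
  case (step1 i)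
  then have "shift_map (\<lambda>t. y (t + i)) \<in> Y"
    using assms(1) by (auto simp: subshift_def)
  then show ?case by (simp add: shift_map_def algebra_simps)
next
  case (step2 i)
  then obtain z where z: "z \<in> Y" "(\<lambda>t. y (t + i)) = shift_map z"
    using assms(1) by (auto simp: subshift_def)
  have "z t = y (t + (i - 1))" for t
    using fun_cong[OF z(2), of "t - 1"] by (simp add: shift_map_def algebra_simps)
  then have "z = (\<lambda>t. y (t + (i - 1)))" by blast
  then show ?case using z(1) by simp
qed

lemma funpow_shift_map: "(shift_map ^^ n) x = (\<lambda>t. x (t + int n))"
  by (induction n) (auto simp: shift_map_def algebra_simps)

text \<open>Irreducibility applied to two cylinders glues finite patterns. Only
  \<open>k \<ge> 1\<close> is guaranteed, so patterns that must not overlap need an offset in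
  \<open>G\<close>.\<close>

lemma irreducible_subshift_connect:
  assumes Y: "irreducible_subshift A Y" and "y \<in> Y" "z \<in> Y" and "finite F" "finite G"
  obtains w k where "w \<in> Y" "k \<ge> 1" "\<And>t. t \<in> F \<Longrightarrow> w t = y t" "\<And>t. t \<in> G \<Longrightarrow> w (t + int k) = z t"
proof -
  have sub: "Y \<subseteq> topspace (full_shift A)"
    using Y closedin_subset by (auto simp: irreducible_subshift_def subshift_def)
  let ?W = "{w \<in> Y. \<forall>i\<in>F. w i = y i}" and ?U = "{w \<in> Y. \<forall>i\<in>G. w i = z i}"
  have "\<exists>n\<ge>1. ?U \<inter> (shift_map ^^ n) ` ?W \<noteq> {}"
    using Y openin_cylinder[OF sub \<open>finite F\<close>, of y] openin_cylinder[OF sub \<open>finite G\<close>, of z]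
      assms(2,3) unfolding irreducible_subshift_def by blast
  then show thesis
    using that by (auto simp: funpow_shift_map)
qed

section \<open>First-return words\<close>

text \<open>Occurrences of \<open>p\<close> may overlap, so a return word may be shorter than
  \<open>p\<close>. For empty \<open>p\<close> the return words are the single letters.\<close>

definition return_words :: "'a list \<Rightarrow> 'a list set" where
  "return_words p = {w. w \<noteq> [] \<and> prefix p (w @ p) \<and>
     (\<forall>k. 0 < k \<and> k < length w \<longrightarrow> \<not> prefix p (drop k (w @ p)))}"

lemma prefix_concat_return_words:
  assumes "set ws \<subseteq> return_words p"
  shows "prefix p (concat ws @ p)"
  using assms
proof (induction ws)
  case (Cons w ws)
  then have "prefix p (w @ p)" "prefix (w @ p) (w @ concat ws @ p)"
    by (auto simp: return_words_def)
  then show ?case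
    by (metis append.assoc concat.simps(2) prefix_order.trans)
qed simp

text \<open>An occurrence starting inside the first factor \<open>w\<close> fits into
  \<open>w @ p\<close>, since what follows \<open>w\<close> begins with \<open>p\<close>; the
  first-return condition then puts it at 0. Otherwise \<open>w\<close> can be stripped.\<close>

lemma occurrence_in_concat_return_words:
  assumes "set ws \<subseteq> return_words p" and "prefix p (drop k (concat ws @ p))"
    and "k \<le> length (concat ws)"
  shows "\<exists>j\<le>length ws. k = length (concat (take j ws))"
  using assms
proof (induction ws arbitrary: k)
  case (Cons w ws)
  show ?case
  proof (cases "k < length w")
    case True
    have "prefix (w @ p) (w @ concat ws @ p)"
      using prefix_concat_return_words[of ws p] Cons.prems by simp
    then have "prefix (drop k (w @ p)) (drop k (concat (w # ws) @ p))"
      using True by (auto simp: prefix_def)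
    moreover have "length p \<le> length (drop k (w @ p))"
      using True by simp
    ultimately have "prefix p (drop k (w @ p))"
      using Cons.prems(2) prefix_length_prefix by blast
    then have "k = 0"
      using True Cons.prems(1) by (auto simp: return_words_def)
    then show ?thesis by (intro exI[of _ 0]) auto
  next
    case False
    have "k - length w \<le> length (concat ws)"
      using Cons.prems(3) by simp
    then obtain j where "j \<le> length ws" "k - length w = length (concat (take j ws))"
      using False Cons.IH[of "k - length w"] Cons.prems(1,2) by auto
    then show ?thesis
      using False by (intro exI[of _ "Suc j"]) auto
  qed
qed simp

text \<open>The shorter word would place an occurrence of \<open>p\<close> strictly inside the
  longer one.\<close>

lemma return_words_prefix_unique:
  assumes "v \<in> return_words p" "w \<in> return_words p"
    and "prefix (v @ p) x" "prefix (w @ p) x"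
  shows "v = w"
proof -
  have *: "\<not> length v < length w"
    if "v \<in> return_words p" "w \<in> return_words p" "prefix (v @ p) x" "prefix (w @ p) x" for v w
  proof
    assume l: "length v < length w"
    have "prefix (v @ p) (w @ p)"
      using that(3,4) l by (auto intro: prefix_length_prefix)
    then obtain zs where "w @ p = (v @ p) @ zs"
      by (auto simp: prefix_def)
    then have "prefix p (drop (length v) (w @ p))"
      by (metis append.assoc append_eq_conv_conj prefixI)
    then show False
      using that(1,2) l by (auto simp: return_words_def)
  qed
  have "length v = length w"
    using *[OF assms] *[OF assms(2,1,4,3)] by simp
  then show ?thesis
    using assms(3,4) by (auto simp: prefix_def)
qed

text \<open>Return words decode uniquely from left to right, so comparing words reduces to comparing
  lists of factors.\<close>

lemma prefix_concat_return_words_iff: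
  assumes "set vs \<subseteq> return_words p" "set ws \<subseteq> return_words p"
  shows "prefix (concat vs @ p) (concat ws @ p) \<longleftrightarrow> prefix vs ws"
proof
  assume "prefix vs ws"
  then obtain us where us: "ws = vs @ us" by (auto simp: prefix_def)
  then show "prefix (concat vs @ p) (concat ws @ p)"
    using prefix_concat_return_words[of us p] assms by simp
next
  show "prefix (concat vs @ p) (concat ws @ p) \<Longrightarrow> prefix vs ws"
    using assms
  proof (induction vs arbitrary: ws)
    case (Cons v vs)
    have v: "v \<in> return_words p" "v \<noteq> []"
      using Cons.prems by (auto simp: return_words_def)
    have "prefix (v @ p) (v @ concat vs @ p)"
      using prefix_concat_return_words[of vs p] Cons.prems by simp
    then have pv: "prefix (v @ p) (concat ws @ p)"
      using Cons.prems(1) by (metis append.assoc concat.simps(2) prefix_order.trans)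
    show ?case
    proof (cases ws)
      case Nil
      then show ?thesis
        using prefix_length_le[OF pv] v(2) by simp
    next
      case (Cons w us)
      have "prefix (w @ p) (concat ws @ p)"
        using prefix_concat_return_words[of us p] Cons.prems(3) Cons by simp
      then have "v = w"
        using return_words_prefix_unique[OF v(1) _ pv] Cons.prems(3) Cons by simp
      then show ?thesis
        using Cons.IH[of us] Cons.prems Cons by simp
    qed
  qed simp
qed

section \<open>Admissibility of concatenated return words\<close>

definition legal :: "'a set \<Rightarrow> nat \<Rightarrow> 'a list set \<Rightarrow> 'a list \<Rightarrow> bool" where
  "legal A n S w \<longleftrightarrow> set w \<subseteq> A \<and> (\<forall>k. k + n \<le> length w \<longrightarrow> take n (drop k w) \<in> S)"

text \<open>A window of length \<open>n \<le> length p\<close> starting in the first factor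
  \<open>w\<close> ends inside \<open>w @ p\<close>, since the remainder begins with
  \<open>p\<close>; every other window lies in the remainder.\<close>

lemma legal_concat_return_words:
  assumes "set ws \<subseteq> return_words p" and "\<And>w. w \<in> set ws \<Longrightarrow> legal A n S (w @ p)"
    and "legal A n S p" and "n \<le> length p"
  shows "legal A n S (concat ws @ p)"
  using assms(1,2)
proof (induction ws)
  case Nil
  then show ?case using assms(3) by simp
next
  case (Cons w ws)
  have IH: "legal A n S (concat ws @ p)"
    using Cons by simp
  have w: "legal A n S (w @ p)"
    using Cons.prems(2) by simp
  obtain q where q: "concat ws @ p = p @ q"
    using prefix_concat_return_words[of ws p] Cons.prems(1) by (auto simp: prefix_def)
  have "take n (drop k (w @ concat ws @ p)) \<in> S"
    if k: "k + n \<le> length (w @ concat ws @ p)" for k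
  proof (cases "k < length w")
    case True
    have "take n (drop k (w @ concat ws @ p)) = take n (drop k (w @ p))"
      using True assms(4) unfolding q by simp
    moreover have "take n (drop k (w @ p)) \<in> S"
      using w True assms(4) unfolding legal_def by (metis add_mono length_append less_imp_le)
    ultimately show ?thesis by simp
  next
    case False
    then have "take n (drop (k - length w) (concat ws @ p)) \<in> S"
      using IH k unfolding legal_def by (auto simp del: take_append drop_append)
    moreover have "drop k (w @ concat ws @ p) = drop (k - length w) (concat ws @ p)"
      using False by (subst drop_append) simp
    ultimately show ?thesis by simp
  qed
  then show ?case
    using IH w by (auto simp: legal_def)
qed

lemma ex_return_word:
  assumes "word x i n = p" "word x j n = p" "i < j"
  obtains l where "i < l" "l \<le> j" "word x l n = p" "word x i (nat (l - i)) \<in> return_words p"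
proof -
  define P where "P d \<longleftrightarrow> 0 < d \<and> word x (i + int d) n = p" for d
  define d where "d = (LEAST d. P d)"
  have j: "P (nat (j - i))"
    using assms by (simp add: P_def)
  have d: "P d" "d \<le> nat (j - i)"
    unfolding d_def using j by (auto intro: LeastI Least_le)
  have least: "\<not> P k" if "k < d" for k
    using that not_less_Least unfolding d_def by blast
  have p: "length p = n" using assms(1) by auto
  have app: "word x i d @ p = word x i (d + n)"
    using d(1) word_append[of x i d n] by (simp add: P_def)
  have pre: "prefix p (drop k (word x i d @ p)) \<longleftrightarrow> word x (i + int k) n = p" if "k \<le> d" for k
  proof -
    have "prefix p (drop k (word x i d @ p)) \<longleftrightarrow> take n (drop k (word x i d @ p)) = p"
      using p by (metis append_eq_conv_conj prefix_def take_is_prefix)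
    then show ?thesis
      using that by (simp add: app drop_word take_word)
  qed
  have "word x i d \<noteq> []"
    using d(1) by (simp add: P_def flip: length_0_conv)
  moreover have "\<not> prefix p (drop k (word x i d @ p))" if "0 < k" "k < d" for k
    using pre[of k] least[of k] that by (simp add: P_def)
  ultimately have "word x i d \<in> return_words p"
    unfolding return_words_def using pre[of 0] assms(1) by (simp del: drop_append)
  then show thesis
    using that[of "i + int d"] d assms(3) by (auto simp: P_def)
qed

section \<open>Two distinct return words in an infinite irreducible subshift\<close>

lemma finite_periodic_sequences:
  assumes "finite A" and "0 < d"
  shows "finite {x :: int \<Rightarrow> 'a. (\<forall>t. x t \<in> A) \<and> (\<forall>t. x (t + int d) = x t)}" (is "finite ?Z")
proof (rule finite_subset)
  let ?g = "\<lambda>f t. f (t mod int d)"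
  show "finite (?g ` (PiE {0..<int d} (\<lambda>_. A)))"
    using assms(1) by (intro finite_imageI finite_PiE) auto
  show "?Z \<subseteq> ?g ` (PiE {0..<int d} (\<lambda>_. A))"
  proof
    fix x assume x: "x \<in> ?Z"
    have per: "x (t + k * int d) = x t" for t k
    proof (induction k rule: int_induct[where k = 0])
      case (step1 i)
      then show ?case
        using x[simplified] by (metis add.assoc distrib_right mult_1)
    next
      case (step2 i)
      have "x (t + (i - 1) * int d + int d) = x (t + (i - 1) * int d)"
        using x by blast
      then show ?case
        using step2 by (simp add: algebra_simps)
    qed simp
    have "x t = x (t mod int d)" for t
      using per[of "t mod int d" "t div int d"] by simp
    then have "x = ?g (restrict x {0..<int d})"
      using assms(2) by (auto simp: fun_eq_iff)
    then show "x \<in> ?g ` (PiE {0..<int d} (\<lambda>_. A))"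
      using x by (intro image_eqI) auto
  qed
qed

text \<open>A violation of the period \<open>d\<close>, the length of one return word, is glued
  between two occurrences of \<open>p\<close>. If the return words around it all equalled the first
  one, they would enforce that period there.\<close>

lemma two_return_words:
  assumes A: "finite A" and Y: "irreducible_subshift A Y" and inf: "infinite Y"
  obtains x i j y k l where "x \<in> Y" "y \<in> Y" "i < j" "k < l"
    "word x i n = word x j n" "word y k n = word x i n" "word y l n = word x i n"
    "word x i (nat (j - i)) \<in> return_words (word x i n)"
    "word y k (nat (l - k)) \<in> return_words (word x i n)"
    "word x i (nat (j - i)) \<noteq> word y k (nat (l - k))"
proof -
  note goal = that
  have sub: "subshift A Y"
    using Y by (simp add: irreducible_subshift_def)
  obtain z where z: "z \<in> Y"
    using Y by (auto simp: irreducible_subshift_def)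
  define p where "p = word z 0 n"
  \<comment> \<open>Gluing \<open>z\<close> to itself makes \<open>p\<close> recur, which yields the
    first return word.\<close>
  obtain x k0 where x: "x \<in> Y" "k0 \<ge> 1" "\<And>t. t \<in> {0..<int n} \<Longrightarrow> x t = z t"
      "\<And>t. t \<in> {0..<int n} \<Longrightarrow> x (t + int k0) = z t"
    using irreducible_subshift_connect[OF Y z z, of "{0..<int n}" "{0..<int n}"] by auto
  have "word x 0 n = p" "word x (int k0) n = p"
    using x(3,4) by (auto simp: p_def word_eq_iff add.commute)
  then obtain j where j: "0 < j" "word x j n = p" "word x 0 (nat j) \<in> return_words p"
    using ex_return_word[of x 0 n p "int k0"] x(2) by auto
  note x0 = \<open>word x 0 n = p\<close>
  define d where "d = nat j"
  have d: "0 < d" using j by (simp add: d_def)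
  have "\<exists>y\<in>Y. \<exists>t. y (t + int d) \<noteq> y t"
  proof (rule ccontr)
    assume "\<not> ?thesis"
    moreover have "Y \<subseteq> topspace (full_shift A)"
      using sub closedin_subset by (auto simp: subshift_def)
    ultimately have "Y \<subseteq> {x. (\<forall>t. x t \<in> A) \<and> (\<forall>t. x (t + int d) = x t)}"
      by (auto simp: topspace_full_shift)
    then show False
      using finite_periodic_sequences[OF A d] inf finite_subset by blast
  qed
  then obtain y0 t0 where y0: "y0 \<in> Y" "y0 (t0 + int d) \<noteq> y0 t0" by blast
  define y1 where "y1 = (\<lambda>t. y0 (t + t0))"
  have y1: "y1 \<in> Y" "y1 (int d) \<noteq> y1 0"
    using y0 subshift_translate[OF sub y0(1), of t0] by (auto simp: y1_def add.commute)
  obtain w1 k where w1: "w1 \<in> Y" "k \<ge> 1" "\<And>t. t \<in> {0..<int n} \<Longrightarrow> w1 t = z t"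
      "\<And>t. t \<in> {0..int d} \<Longrightarrow> w1 (t + int k) = y1 t"
    using irreducible_subshift_connect[OF Y z y1(1), of "{0..<int n}" "{0..int d}"] by auto
  \<comment> \<open>With this offset the closing copy of \<open>p\<close> starts after both
    positions \<open>k\<close> and \<open>k + d\<close> of the violation.\<close>
  define M where "M = int k + int d + 1"
  have zM: "(\<lambda>t. z (t + - M)) \<in> Y"
    by (rule subshift_translate[OF sub z])
  obtain w k2 where w: "w \<in> Y" "k2 \<ge> 1" "\<And>t. t \<in> {0..M + int n} \<Longrightarrow> w t = w1 t"
      "\<And>t. t \<in> {M..M + int n} \<Longrightarrow> w (t + int k2) = z (t + - M)"
    using irreducible_subshift_connect[OF Y w1(1) zM, of "{0..M + int n}" "{M..M + int n}"] by auto
  define b where "b = M + int k2"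
  have occ0: "word w 0 n = p"
    using w1(3) w(3) by (auto simp: p_def word_eq_iff M_def)
  have occb: "word w b n = p"
    unfolding p_def word_eq_iff
  proof (intro conjI allI impI)
    fix s assume "s < n"
    then show "w (b + int s) = word z 0 n ! s"
      using w(4)[of "M + int s"] by (simp add: b_def algebra_simps)
  qed simp
  have neq: "w (int k + int d) \<noteq> w (int k)"
    using w(3)[of "int k + int d"] w(3)[of "int k"] w1(4)[of 0] w1(4)[of "int d"] y1(2)
    by (simp add: M_def add.commute)
  have b: "int k + int d < b" by (simp add: b_def M_def)
  \<comment> \<open>The last occurrence of \<open>p\<close> at or before \<open>k\<close>; position
    0 is a candidate. The return from \<open>c\<close> therefore ends beyond
    \<open>k\<close>.\<close>
  define c where "c = Max {c \<in> {0..int k}. word w c n = p}"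
  have "c \<in> {c \<in> {0..int k}. word w c n = p}"
    unfolding c_def by (rule Max_in) (use occ0 in \<open>auto intro: finite_subset[of _ "{0..int k}"]\<close>)
  then have c: "0 \<le> c" "c \<le> int k" "word w c n = p" by auto
  have cmax: "s \<le> c" if "s \<in> {0..int k}" "word w s n = p" for s
    unfolding c_def by (rule Max_ge) (use that in \<open>auto intro: finite_subset[of _ "{0..int k}"]\<close>)
  obtain c1 where c1: "c < c1" "c1 \<le> b" "word w c1 n = p" "word w c (nat (c1 - c)) \<in> return_words p"
    using ex_return_word[OF c(3) occb] c b by auto
  have kc1: "int k < c1"
    using cmax[of c1] c1 c by force
  have fin: thesis if "word w e n = p" "word w e1 n = p" "e < e1"
      "word w e (nat (e1 - e)) \<in> return_words p" "word x 0 (nat j) \<noteq> word w e (nat (e1 - e))" for e e1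
    by (rule goal[of x w 0 j e e1]) (use that x(1) w(1) j x0 in auto)
  show thesis
  proof (cases "word w c (nat (c1 - c)) = word x 0 (nat j)")
    case False
    then show ?thesis
      using fin[OF c(3) c1(3,1,4)] by simp
  next
    case True
    then have "nat (c1 - c) = nat j"
      by (metis length_word)
    then have c1c: "c1 = c + int d"
      using c1(1) j(1) by (simp add: d_def)
    obtain c2 where c2: "c1 < c2" "word w c2 n = p" "word w c1 (nat (c2 - c1)) \<in> return_words p"
      using ex_return_word[OF c1(3) occb] c b c1c by auto
    show ?thesis
    proof (cases "word w c1 (nat (c2 - c1)) = word x 0 (nat j)")
      case False
      then show ?thesis
        using fin[OF c1(3) c2(2,1,3)] by simp
    next
      case eq: True
      have "nat (c2 - c1) = d"
        using eq by (metis length_word d_def)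
      then have e: "word w c d = word w c1 d"
        using eq True c1c by (metis \<open>nat (c1 - c) = nat j\<close> d_def)
      \<comment> \<open>Two equal consecutive factors of length \<open>d\<close> contain
        \<open>k\<close> and \<open>k + d\<close> at the same offset.\<close>
      have "w (int k) = w (int k + int d)"
        using arg_cong[OF e, of "\<lambda>u. u ! nat (int k - c)"] c kc1 c1c by (simp add: algebra_simps)
      then show ?thesis using neq by simp
    qed
  qed
qed

section \<open>Recoding marked blocks\<close>

text \<open>\<open>U\<close> and \<open>V\<close> are blocks of length \<open>L\<close> followed by a copy of the common initial word \<open>P\<close>.
  Occurrences at distance exactly \<open>L\<close> are allowed and form the runs on which blocks are recoded.\<close>

locale marker_pair =
  fixes P U V :: "'a list" and L :: nat
  assumes L_pos: "0 < L"
    and length_block: "W \<in> {U, V} \<Longrightarrow> length W = L + length P"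
    and take_block: "W \<in> {U, V} \<Longrightarrow> take (length P) W = P"
    and drop_block: "W \<in> {U, V} \<Longrightarrow> drop L W = P"
    and no_overlap: "W \<in> {U, V} \<Longrightarrow> 0 < k \<Longrightarrow> k < L \<Longrightarrow> take (length P) (drop k W) \<noteq> P"
    and U_neq_V: "U \<noteq> V"
begin

definition occ :: "(int \<Rightarrow> 'a) \<Rightarrow> int \<Rightarrow> bool" where
  "occ x i \<longleftrightarrow> word x i (L + length P) \<in> {U, V}"

definition mark :: "(int \<Rightarrow> 'a) \<Rightarrow> int \<Rightarrow> bool" where
  "mark x i \<longleftrightarrow> word x i (L + length P) = V"

definition block :: "bool \<Rightarrow> 'a list" where
  "block b = (if b then V else U)"

text \<open>Only the first \<open>L\<close> letters of an occurrence are rewritten, as its final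
  \<open>P\<close> may already belong to the next block. \<open>occ_unique\<close> justifies the
  \<open>THE\<close>.\<close>

definition recode :: "(int \<Rightarrow> 'a) \<Rightarrow> (int \<Rightarrow> bool) \<Rightarrow> int \<Rightarrow> 'a" where
  "recode x c t =
     (if \<exists>i. occ x i \<and> i \<le> t \<and> t < i + int L
      then let i = (THE i. occ x i \<and> i \<le> t \<and> t < i + int L) in block (c i) ! nat (t - i)
      else x t)"

text \<open>Inequality of booleans is addition mod 2; the conjunction supplies the bit 0 after the
  end of a run.\<close>

definition tau :: "(int \<Rightarrow> 'a) \<Rightarrow> int \<Rightarrow> 'a" where
  "tau x = recode x (\<lambda>i. mark x i \<noteq> (occ x (i + int L) \<and> mark x (i + int L)))"

section \<open>Rigidity of occurrences under recoding\<close>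

lemma block_in: "block b \<in> {U, V}"
  by (simp add: block_def)

lemma length_block_bool [simp]: "length (block b) = L + length P"
  using length_block[OF block_in] .

lemma block_nth_first: "k < length P \<Longrightarrow> block b ! k = P ! k"
  using take_block[OF block_in[of b]] by (metis nth_take)

lemma block_nth_last: "k < length P \<Longrightarrow> block b ! (L + k) = P ! k"
  using drop_block[OF block_in[of b]] by (metis nth_drop length_block_bool le_add1)

lemma occ_word: "occ x i \<Longrightarrow> word x i (L + length P) = block (mark x i)"
  by (auto simp: occ_def mark_def block_def)

lemma occ_nth: "occ x i \<Longrightarrow> k < L + length P \<Longrightarrow> x (i + int k) = block (mark x i) ! k"
  using occ_word[of x i] by (metis nth_word)

text \<open>A closer second occurrence would show its initial \<open>P\<close> strictly inside the
  first block.\<close>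

lemma occ_apart:
  assumes "occ x i" "occ x j" "i < j"
  shows "i + int L \<le> j"
proof (rule ccontr)
  assume "\<not> ?thesis"
  then have k: "0 < nat (j - i)" "nat (j - i) < L"
    using assms(3) by auto
  have "take (length P) (drop (nat (j - i)) (word x i (L + length P))) = word x j (length P)"
    using k assms(3) by (simp add: drop_word take_word)
  also have "\<dots> = take (length P) (word x j (L + length P))"
    by (simp add: take_word)
  also have "\<dots> = P"
    using assms(2) take_block unfolding occ_def by blast
  finally show False
    using no_overlap[OF _ k] assms(1) unfolding occ_def by blast
qed

lemma occ_unique:
  assumes "occ x i" "i \<le> t" "t < i + int L" "occ x j" "j \<le> t" "t < j + int L"
  shows "i = j"
  using occ_apart[of x i j] occ_apart[of x j i] assms by linarith

lemma recode_block:
  assumes "occ x i" "i \<le> t" "t < i + int L"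
  shows "recode x c t = block (c i) ! nat (t - i)"
proof -
  have "(THE i. occ x i \<and> i \<le> t \<and> t < i + int L) = i"
    using assms occ_unique by (intro the_equality) blast+
  then show ?thesis
    using assms unfolding recode_def by auto
qed

lemma recode_outside:
  assumes "\<And>i. occ x i \<Longrightarrow> i \<le> t \<Longrightarrow> t < i + int L \<Longrightarrow> False"
  shows "recode x c t = x t"
  using assms unfolding recode_def by auto

text \<open>Both blocks begin with \<open>P\<close>, so only letters between the initial and the
  final \<open>P\<close> can change.\<close>

lemma recode_changed:
  assumes "recode x c t \<noteq> x t"
  obtains i where "occ x i" "i + int (length P) \<le> t" "t < i + int L"
proof -
  obtain i where i: "occ x i" "i \<le> t" "t < i + int L"
    using assms recode_outside by blast
  have "i + int (length P) \<le> t"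
  proof (rule ccontr)
    assume "\<not> ?thesis"
    then have "nat (t - i) < length P" using i by simp
    then have "recode x c t = P ! nat (t - i)" "x t = P ! nat (t - i)"
      using recode_block[OF i] occ_nth[OF i(1), of "nat (t - i)"] i(2)
      by (simp_all add: block_nth_first)
    then show False using assms by simp
  qed
  then show thesis using that i by blast
qed

lemma word_recode:
  assumes i: "occ x i"
  shows "word (recode x c) i (L + length P) = block (c i)"
  unfolding word_eq_iff
proof (intro conjI allI impI)
  fix k assume k: "k < L + length P"
  show "recode x c (i + int k) = block (c i) ! k"
  proof (cases "k < L")
    case True
    then show ?thesis using recode_block[OF i] by simp
  next
    case False
    then obtain l where l: "k = L + l" "l < length P"
      using k by (metis add_less_cancel_left le_Suc_ex not_less)
    \<comment> \<open>A change in the final \<open>P\<close> would lie beyond the initial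
      \<open>P\<close> of a later occurrence; but that one starts no earlier than
      \<open>i + L\<close>, so its initial \<open>P\<close> reaches at least as far.\<close>
    have "recode x c (i + int k) = x (i + int k)"
    proof (rule ccontr)
      assume "\<not> ?thesis"
      then obtain j where j: "occ x j" "j + int (length P) \<le> i + int k" "i + int k < j + int L"
        by (rule recode_changed)
      then show False
        using occ_apart[OF i j(1)] l by simp
    qed
    then show ?thesis
      using occ_nth[OF i k] l block_nth_last by simp
  qed
qed simp

text \<open>A new occurrence would contain a changed letter, hence meet the middle of an old
  occurrence, which survives recoding. By \<open>occ_apart\<close> in the recoded point the two
  coincide.\<close>

lemma occ_recode: "occ (recode x c) i \<longleftrightarrow> occ x i"
proof
  assume "occ x i"
  then show "occ (recode x c) i"
    using word_recode block_in unfolding occ_def by metis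
next
  assume i: "occ (recode x c) i"
  show "occ x i"
  proof (cases "word (recode x c) i (L + length P) = word x i (L + length P)")
    case True
    then show ?thesis using i by (simp add: occ_def)
  next
    case False
    then obtain k where k: "k < L + length P" "recode x c (i + int k) \<noteq> x (i + int k)"
      by (auto simp: list_eq_iff_nth_eq)
    obtain j where j: "occ x j" "j + int (length P) \<le> i + int k" "i + int k < j + int L"
      using k(2) by (rule recode_changed)
    have "occ (recode x c) j"
      using word_recode[OF j(1)] block_in unfolding occ_def by metis
    then have "i = j"
      using occ_apart[OF i, of j] occ_apart[of "recode x c" j i] i j k(1) by linarith
    then show ?thesis using j(1) by simp
  qed
qed

lemma mark_recode: "occ x i \<Longrightarrow> mark (recode x c) i = c i"
  using word_recode[of x i c] U_neq_V by (auto simp: mark_def block_def)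

lemma recode_cong:
  assumes "\<And>i. occ x i \<Longrightarrow> c i = c' i"
  shows "recode x c = recode x c'"
proof
  fix t
  show "recode x c t = recode x c' t"
  proof (cases "\<exists>i. occ x i \<and> i \<le> t \<and> t < i + int L")
    case True
    then obtain i where i: "occ x i" "i \<le> t" "t < i + int L" by blast
    show ?thesis
      unfolding recode_block[OF i] using assms[OF i(1)] by simp
  next
    case False
    then show ?thesis unfolding recode_def by (simp only: if_False)
  qed
qed

lemma recode_recode: "recode (recode x c) c' = recode x c'"
proof
  fix t
  show "recode (recode x c) c' t = recode x c' t"
  proof (cases "\<exists>i. occ x i \<and> i \<le> t \<and> t < i + int L")
    case True
    then obtain i where i: "occ x i" "i \<le> t" "t < i + int L" by blast
    then have i': "occ (recode x c) i" by (simp add: occ_recode)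
    show ?thesis
      unfolding recode_block[OF i] recode_block[OF i' i(2,3)] ..
  next
    case False
    then have "recode (recode x c) c' t = recode x c t"
      by (intro recode_outside) (auto simp: occ_recode)
    then show ?thesis
      using False unfolding recode_def[of x] by (simp only: if_False)
  qed
qed

lemma recode_mark: "recode x (mark x) = x"
proof
  fix t
  show "recode x (mark x) t = x t"
  proof (cases "\<exists>i. occ x i \<and> i \<le> t \<and> t < i + int L")
    case True
    then obtain i where i: "occ x i" "i \<le> t" "t < i + int L" by blast
    then show ?thesis
      using recode_block[OF i] occ_nth[OF i(1), of "nat (t - i)"] by simp
  next
    case False
    then show ?thesis using recode_outside by blast
  qed
qed

section \<open>The map on bits, its locality and its commutation with the shift\<close>

lemma tau_recode:
  "tau (recode x c) = recode x (\<lambda>i. c i \<noteq> (occ x (i + int L) \<and> c (i + int L)))"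
  \<comment> \<open>\<open>recode x c\<close> has the occurrences of \<open>x\<close> with the bits
    \<open>c\<close>, so only the bits need to be compared.\<close>
  unfolding tau_def recode_recode by (rule recode_cong) (auto simp: occ_recode mark_recode)

text \<open>The block rewritten at \<open>t\<close> starts after \<open>t - L\<close>; its successor
  starts no later than \<open>t + L\<close> and has length \<open>L + length P\<close>.\<close>

lemma tau_local:
  assumes "\<And>s. s \<in> {t - int L..t + 2 * int L + int (length P)} \<Longrightarrow> x s = y s"
  shows "tau x t = tau y t"
proof -
  have w: "word x i (L + length P) = word y i (L + length P)" if "t - int L \<le> i" "i \<le> t + int L" for i
    using that assms by (auto simp: word_eq_iff)
  have eq: "occ x i = occ y i" "mark x i = mark y i" if "t - int L \<le> i" "i \<le> t + int L" for i
    using w[OF that] by (simp_all add: occ_def mark_def)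
  show ?thesis
  proof (cases "\<exists>i. occ x i \<and> i \<le> t \<and> t < i + int L")
    case True
    then obtain i where i: "occ x i" "i \<le> t" "t < i + int L" by blast
    have i': "occ y i" using i eq(1)[of i] by simp
    show ?thesis
      unfolding tau_def recode_block[OF i] recode_block[OF i' i(2,3)]
      using eq[of i] eq[of "i + int L"] i by simp
  next
    case False
    then have "\<not> (\<exists>i. occ y i \<and> i \<le> t \<and> t < i + int L)"
      using eq(1) by (metis add.commute add_increasing diff_le_eq less_imp_le of_nat_0_le_iff)
    then have "tau y t = y t" "tau x t = x t"
      using False recode_outside unfolding tau_def by blast+
    then show ?thesis
      using assms[of t] by simp
  qed
qed

lemma tau_shift: "tau (shift_map x) = shift_map (tau x)"
proof
  fix t
  have w: "word (shift_map x) i l = word x (i + 1) l" for i l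
    unfolding shift_map_def by (rule word_shift)
  have eq: "occ (shift_map x) i = occ x (i + 1)" "mark (shift_map x) i = mark x (i + 1)" for i
    by (simp_all add: occ_def mark_def w)
  show "tau (shift_map x) t = shift_map (tau x) t"
  proof (cases "\<exists>i. occ (shift_map x) i \<and> i \<le> t \<and> t < i + int L")
    case True
    then obtain i where i: "occ (shift_map x) i" "i \<le> t" "t < i + int L" by blast
    have i': "occ x (i + 1)" "i + 1 \<le> t + 1" "t + 1 < i + 1 + int L"
      using i eq(1)[of i] by auto
    show ?thesis
      using recode_block[OF i] recode_block[OF i']
      by (simp add: tau_def shift_map_def[of "recode x _"] eq algebra_simps)
  next
    case False
    have "\<not> (occ x i \<and> i \<le> t + 1 \<and> t + 1 < i + int L)" for i
      using False[simplified eq, simplified, rule_format, of "i - 1"] by auto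
    then have "tau x (t + 1) = x (t + 1)"
      unfolding tau_def by (intro recode_outside) blast
    moreover have "tau (shift_map x) t = shift_map x t"
      using False unfolding tau_def by (intro recode_outside) blast
    ultimately show ?thesis
      by (simp add: shift_map_def)
  qed
qed

section \<open>Two periodic points with the same image\<close>

lemma block_periodic: "k < L + length P \<Longrightarrow> block b ! k = block b ! (k mod L)"
proof (induction k rule: less_induct)
  case (less k)
  show ?case
  proof (cases "k < L")
    case False
    \<comment> \<open>The copies of \<open>P\<close> at offsets 0 and \<open>L\<close> force the
      period \<open>L\<close>, even if they overlap.\<close>
    then have "block b ! k = block b ! (k - L)"
      using block_nth_first[of "k - L" b] block_nth_last[of "k - L" b] less.prems by simp
    then show ?thesis
      using less.IH[of "k - L"] less.prems False L_pos by (simp add: le_mod_geq)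
  qed simp
qed

text \<open>The run of blocks \<open>U\<close> that is infinite in both directions, one starting at
  each multiple of \<open>L\<close>.\<close>

definition base_point :: "int \<Rightarrow> 'a" where
  "base_point t = U ! nat (t mod int L)"

lemma base_point_word:
  assumes "k < L" and "k + n \<le> L + length P"
  shows "word base_point (i * int L + int k) n = take n (drop k U)"
proof -
  have "base_point (i * int L + int k + int s) = U ! (k + s)" if "s < n" for s
  proof -
    have "(i * int L + int k + int s) mod int L = int ((k + s) mod L)"
      by (simp add: add.assoc flip: of_nat_add of_nat_mod)
    then show ?thesis
      using block_periodic[of "k + s" False] that assms(2)
      by (simp add: base_point_def block_def)
  qed
  then show ?thesis
    using assms(2) length_block[of U] by (auto simp: word_eq_iff)
qed

lemma word_base_point_block: "word base_point (q * int L) (L + length P) = U"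
  using base_point_word[of 0 "L + length P" q] L_pos length_block[of U] by simp

lemma occ_base_point_iff: "occ base_point i \<longleftrightarrow> int L dvd i"
proof
  assume i: "occ base_point i"
  have q: "occ base_point (i div int L * int L)"
    by (simp add: occ_def word_base_point_block)
  have "i div int L * int L + i mod int L = i"
    by simp
  moreover have "0 \<le> i mod int L" "i mod int L < int L"
    using L_pos by simp_all
  ultimately have "i mod int L = 0"
    using occ_apart[OF q i] by linarith
  then show "int L dvd i" by (simp add: dvd_eq_mod_eq_0)
next
  assume "int L dvd i"
  then show "occ base_point i"
    by (metis dvd_div_mult_self insertI1 occ_def word_base_point_block)
qed

lemma not_mark_base_point: "occ base_point i \<Longrightarrow> \<not> mark base_point i"
  using U_neq_V word_base_point_block unfolding occ_base_point_iff mark_def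
  by (metis dvd_div_mult_self)

text \<open>On a run without ends, 1 + 1 = 0 + 0 mod 2, so both constant bit sequences are sent to
  0.\<close>

lemma tau_not_injective: "tau (recode base_point (\<lambda>_. True)) = tau base_point"
  "recode base_point (\<lambda>_. True) \<noteq> base_point"
proof -
  have "tau (recode base_point (\<lambda>_. True)) = recode base_point (\<lambda>_. False)"
    unfolding tau_recode by (rule recode_cong) (simp add: occ_base_point_iff)
  moreover have "tau base_point = recode base_point (\<lambda>_. False)"
    unfolding tau_def by (rule recode_cong) (auto simp: not_mark_base_point)
  ultimately show "tau (recode base_point (\<lambda>_. True)) = tau base_point"
    by simp
  have "occ base_point 0"
    by (simp add: occ_base_point_iff)
  then show "recode base_point (\<lambda>_. True) \<noteq> base_point"
    using mark_recode not_mark_base_point by metis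
qed

end

section \<open>Solving the exclusive-or equation along runs\<close>

text \<open>The solution is the parity of the number of places between 0 and \<open>q\<close> where
  \<open>B\<close> holds; for negative \<open>q\<close> the range is \<open>{q..<0}\<close>.\<close>

lemma xor_recurrence_int:
  fixes B :: "int \<Rightarrow> bool"
  shows "\<exists>F. \<forall>q. F (q + 1) = (F q \<noteq> B q)"
proof -
  define G where "G q = {j \<in> {0..<q} \<union> {q..<0}. B j}" for q
  have fin: "finite (G q)" for q
    unfolding G_def by (rule finite_Collect_conjI) simp
  have "odd (card (G (q + 1))) = (odd (card (G q)) \<noteq> B q)" for q
  proof (cases "0 \<le> q")
    case True
    then have "G (q + 1) = (if B q then insert q (G q) else G q)" "q \<notin> G q"
      by (auto simp: G_def less_le)
    then show ?thesis
      using fin by simp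
  next
    case False
    then have "G q = (if B q then insert q (G (q + 1)) else G (q + 1))" "q \<notin> G (q + 1)"
      by (auto simp: G_def add1_zle_eq less_le)
    then show ?thesis
      using fin by simp
  qed
  then show ?thesis
    by (intro exI[of _ "\<lambda>q. odd (card (G q))"]) blast
qed

text \<open>A run with a last element is solved backwards from it; along a run without one the
  recurrence of \<open>xor_recurrence_int\<close> is followed.\<close>

lemma xor_equation_int:
  fixes R B :: "int \<Rightarrow> bool"
  shows "\<exists>c. \<forall>q. R q \<longrightarrow> B q = (c q \<noteq> (R (q + 1) \<and> c (q + 1)))"
proof -
  obtain F where F: "\<And>q. F (q + 1) = (F q \<noteq> B q)"
    using xor_recurrence_int[of B] by blast
  \<comment> \<open>The places from \<open>q\<close> to the end of its run where \<open>B\<close>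
    holds. Their parity is the backward solution with bit 0 beyond the run.\<close>
  define T where "T q = {j. q \<le> j \<and> (\<forall>i\<in>{q..j}. R i) \<and> B j}" for q
  define c where "c q = (if \<forall>j\<ge>q. R j then F q else odd (card (T q)))" for q
  have "B q = (c q \<noteq> (R (q + 1) \<and> c (q + 1)))" if q: "R q" for q
  proof (cases "\<forall>j\<ge>q. R j")
    case True
    \<comment> \<open>The run from \<open>q + 1\<close> is endless too, so both values of
      \<open>c\<close> come from \<open>F\<close>, whose recurrence rearranges to the claim.\<close>
    then show ?thesis
      using F[of q] by (auto simp: c_def)
  next
    case False
    then obtain l where l: "q \<le> l" "\<not> R l" by blast
    then have "q + 1 \<le> l"
      using q by (cases "l = q") auto
    then have c: "c q = odd (card (T q))" "c (q + 1) = odd (card (T (q + 1)))"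
      using l unfolding c_def by meson+
    have "T (q + 1) \<subseteq> {q + 1..l}"
      using l \<open>q + 1 \<le> l\<close> by (force simp: T_def)
    then have fin: "finite (T (q + 1))"
      using finite_subset by blast
    have "j \<in> T q \<longleftrightarrow> j = q \<and> B q \<or> j \<in> T (q + 1)" for j
    proof (cases "q + 1 \<le> j")
      case True
      then have "{q..j} = insert q {q + 1..j}" by auto
      then show ?thesis using True q by (auto simp: T_def)
    next
      case False
      then have "j = q \<or> j < q" by linarith
      then show ?thesis using q by (auto simp: T_def)
    qed
    then have "T q = (if B q then insert q (T (q + 1)) else T (q + 1))"
      by auto
    moreover have "q \<notin> T (q + 1)"
      by (simp add: T_def)
    ultimately have "c q = (B q \<noteq> c (q + 1))"
      using fin by (auto simp: c)
    moreover have "T (q + 1) = {}" if "\<not> R (q + 1)"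
      using that by (auto simp: T_def)
    ultimately show ?thesis
      by (auto simp: c)
  qed
  then show ?thesis by blast
qed

text \<open>Within a residue class mod \<open>L\<close> the successor of \<open>i\<close> is
  \<open>i + L\<close>, so each class is a copy of the integer case.\<close>

lemma xor_equation_step:
  fixes R B :: "int \<Rightarrow> bool" and L :: int
  assumes "0 < L"
  shows "\<exists>c. \<forall>i. R i \<longrightarrow> B i = (c i \<noteq> (R (i + L) \<and> c (i + L)))"
proof -
  have "\<forall>s. \<exists>c. \<forall>q. R (q * L + s) \<longrightarrow>
      B (q * L + s) = (c q \<noteq> (R ((q + 1) * L + s) \<and> c (q + 1)))"
    using xor_equation_int[of "\<lambda>q. R (q * L + _)" "\<lambda>q. B (q * L + _)"] by blast
  then obtain c where c: "\<And>s q. R (q * L + s) \<Longrightarrow>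
      B (q * L + s) = (c s q \<noteq> (R ((q + 1) * L + s) \<and> c s (q + 1)))"
    by metis
  have "B i = (c (i mod L) (i div L) \<noteq> (R (i + L) \<and> c ((i + L) mod L) ((i + L) div L)))"
    if "R i" for i
    using c[of "i div L" "i mod L"] that assms by (simp add: algebra_simps)
  then show ?thesis
    by (intro exI[of _ "\<lambda>i. c (i mod L) (i div L)"]) blast
qed

section \<open>The endomorphism\<close>

definition sft :: "'a set \<Rightarrow> nat \<Rightarrow> 'a list set \<Rightarrow> (int \<Rightarrow> 'a) set" where
  "sft A n S = {x \<in> topspace (full_shift A). \<forall>i. word x i n \<in> S}"

text \<open>Starting windows at \<open>i + 1\<close> or at \<open>i\<close> makes no difference once
  \<open>i\<close> ranges over all integers.\<close>

lemma sft_windows: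
  "{x \<in> topspace (full_shift A). \<forall>i. map (\<lambda>k. x (i + int k)) [1..<n+1] \<in> S} = sft A n S"
proof -
  have "map (\<lambda>k. x (i + int k)) [1..<n+1] = word x (i + 1) n" for x :: "int \<Rightarrow> 'a" and i
    by (rule nth_equalityI) (auto simp: algebra_simps simp del: upt_Suc)
  moreover have "(\<forall>i. word x (i + 1) n \<in> S) \<longleftrightarrow> (\<forall>i. word x i n \<in> S)" for x
    by (metis diff_add_cancel)
  ultimately show ?thesis
    by (simp add: sft_def)
qed

lemma legal_word: "x \<in> sft A n S \<Longrightarrow> legal A n S (word x i l)"
  by (auto simp: legal_def sft_def drop_word take_word topspace_full_shift in_set_conv_nth)

context marker_pair
begin

text \<open>A changed letter has at least \<open>length P \<ge> n\<close> letters of its block on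
  each side, so every window of length \<open>n\<close> through it lies in one legal recoded
  block.\<close>

lemma recode_in_sft:
  assumes x: "x \<in> sft A n S" and n: "n \<le> length P" and U: "legal A n S U" and V: "legal A n S V"
  shows "recode x c \<in> sft A n S"
proof -
  have leg: "legal A n S (block b)" for b
    using U V by (simp add: block_def)
  have "recode x c t \<in> A" for t
  proof (cases "recode x c t = x t")
    case True
    then show ?thesis using x by (auto simp: sft_def topspace_full_shift)
  next
    case False
    then obtain i where i: "occ x i" "i + int (length P) \<le> t" "t < i + int L"
      by (rule recode_changed)
    then have "recode x c t = block (c i) ! nat (t - i)"
      by (intro recode_block) auto
    moreover have "nat (t - i) < length (block (c i))"
      using i by auto
    ultimately show ?thesis
      using leg[of "c i"] nth_mem unfolding legal_def by fastforce
  qed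
  moreover have "word (recode x c) t n \<in> S" for t
  proof (cases "word (recode x c) t n = word x t n")
    case True
    then show ?thesis using x by (simp add: sft_def)
  next
    case False
    then obtain k where k: "k < n" "recode x c (t + int k) \<noteq> x (t + int k)"
      by (auto simp: list_eq_iff_nth_eq)
    obtain i where i: "occ x i" "i + int (length P) \<le> t + int k" "t + int k < i + int L"
      using k(2) by (rule recode_changed)
    define s where "s = nat (t - i)"
    have s: "t = i + int s" "s + n \<le> L + length P"
      using i k n by (auto simp: s_def)
    have "word (recode x c) t n = take n (drop s (word (recode x c) i (L + length P)))"
      using s by (simp add: drop_word take_word)
    then show ?thesis
      using leg[of "c i"] s(2) unfolding word_recode[OF i(1)] legal_def by simp
  qed
  ultimately show ?thesis
    by (simp add: sft_def topspace_full_shift)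
qed

lemma base_point_in_sft:
  assumes n: "n \<le> length P" and U: "legal A n S U"
  shows "base_point \<in> sft A n S"
proof -
  have "base_point t \<in> A" for t
  proof -
    have "nat (t mod int L) < length U"
      using L_pos length_block[of U] by (simp add: nat_less_iff trans_less_add1)
    then show ?thesis
      using U nth_mem unfolding legal_def base_point_def by blast
  qed
  moreover have "word base_point t n \<in> S" for t
  proof -
    have k: "nat (t mod int L) < L"
      using L_pos by (simp add: nat_less_iff)
    have "word base_point t n = take n (drop (nat (t mod int L)) U)"
      using base_point_word[OF k, of n "t div int L"] k n L_pos by simp
    then show ?thesis
      using U k n length_block[of U] unfolding legal_def by simp
  qed
  ultimately show ?thesis
    by (simp add: sft_def topspace_full_shift)
qed

lemma sft_not_injunctive:
  assumes n: "n \<le> length P" and U: "legal A n S U" and V: "legal A n S V"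
  shows "\<not> injunctive A (sft A n S)"
proof -
  let ?X = "sft A n S"
  note rec = recode_in_sft[OF _ n U V]
  have sub: "?X \<subseteq> topspace (full_shift A)"
    by (auto simp: sft_def)
  have tau: "tau ` ?X \<subseteq> ?X"
    using rec by (auto simp: tau_def)
  have "continuous_map (subtopology (full_shift A) ?X) (subtopology (full_shift A) ?X) tau"
  proof (rule continuous_map_full_shiftI[OF sub tau])
    fix t
    show "\<exists>F. finite F \<and> (\<forall>x\<in>?X. \<forall>y\<in>?X. (\<forall>i\<in>F. x i = y i) \<longrightarrow> tau x t = tau y t)"
      by (intro exI[of _ "{t - int L..t + 2 * int L + int (length P)}"] conjI ballI impI tau_local)
        (simp, blast)
  qed
  then have "endomorphism A ?X tau"
    by (simp add: endomorphism_def tau_shift)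
  moreover have "y \<in> tau ` ?X" if y: "y \<in> ?X" for y
  proof -
    \<comment> \<open>The bits of a preimage: solving for the marks of \<open>y\<close> makes
      \<open>tau\<close> send \<open>recode y c\<close> back to \<open>y\<close>.\<close>
    obtain c where c: "\<And>i. occ y i \<Longrightarrow> mark y i = (c i \<noteq> (occ y (i + int L) \<and> c (i + int L)))"
      using xor_equation_step[of "int L" "occ y" "mark y"] L_pos by auto
    have "tau (recode y c) = recode y (mark y)"
      unfolding tau_recode by (rule recode_cong) (use c in blast)
    then show ?thesis
      using rec[OF y] recode_mark[of y] by (metis imageI)
  qed
  moreover have "\<not> inj_on tau ?X"
    using tau_not_injective base_point_in_sft[OF n U] rec unfolding inj_on_def by metis
  ultimately show ?thesis
    using tau unfolding injunctive_def by blast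
qed

end

text \<open>An occurrence of \<open>aap\<close> starts at a factor boundary followed by two factors
  \<open>a\<close>. Both factor lists have this only at indices 0 and 6, and in both the first six
  factors have total length \<open>L\<close>.\<close>

lemma marker_pair_of_return_words:
  assumes a: "a \<in> return_words p" and b: "b \<in> return_words p" and ab: "a \<noteq> b"
  shows "marker_pair (concat [a, a] @ p) (concat [a, a, b, a, b, b, a, a] @ p)
    (concat [a, a, b, b, a, b, a, a] @ p) (3 * length a + 3 * length b)"
    (is "marker_pair ?P ?U ?V ?L")
proof -
  let ?us = "[a, a, b, a, b, b, a, a]" and ?vs = "[a, a, b, b, a, b, a, a]"
  have W: "\<exists>ws. W = concat ws @ p \<and> ws \<in> {?us, ?vs}" if "W \<in> {?U, ?V}" for W
    using that by blast
  have ret: "set ws \<subseteq> return_words p" if "ws \<in> {?us, ?vs}" for ws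
    using that a b by auto
  show ?thesis
  proof
    show "0 < ?L"
      using a by (auto simp: return_words_def)
    show "length W = ?L + length ?P" if "W \<in> {?U, ?V}" for W
      using that by auto
    show "take (length ?P) W = ?P" if W': "W \<in> {?U, ?V}" for W
    proof -
      obtain ws where ws: "W = concat ws @ p" "ws \<in> {?us, ?vs}"
        using W[OF W'] by blast
      have "prefix ?P W"
        unfolding ws(1) using a ws(2) by (subst prefix_concat_return_words_iff) (auto simp: ret[OF ws(2)])
      then show ?thesis
        by (auto simp: prefix_def)
    qed
    show "drop ?L W = ?P" if "W \<in> {?U, ?V}" for W
      using that by auto
    show "take (length ?P) (drop k W) \<noteq> ?P" if W': "W \<in> {?U, ?V}" and k: "0 < k" "k < ?L" for W k
    proof
      assume eq: "take (length ?P) (drop k W) = ?P"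
      obtain ws where ws: "W = concat ws @ p" "ws \<in> {?us, ?vs}"
        using W[OF W'] by blast
      have pre: "prefix ?P (drop k W)"
        using eq by (metis take_is_prefix)
      have "prefix p ?P"
        using a by (intro prefix_concat_return_words) simp
      then have "prefix p (drop k (concat ws @ p))"
        using pre ws(1) prefix_order.trans by blast
      moreover have "k \<le> length (concat ws)"
        using k ws(2) by auto
      ultimately obtain j where j: "j \<le> length ws" "k = length (concat (take j ws))"
        using occurrence_in_concat_return_words[OF ret[OF ws(2)]] by blast
      have "concat ws = concat (take j ws) @ concat (drop j ws)"
        by (metis append_take_drop_id concat_append)
      then have "drop k W = concat (drop j ws) @ p"
        using j(2) ws(1) by simp
      then have "prefix [a, a] (drop j ws)"
        using pre prefix_concat_return_words_iff[of "[a, a]" p "drop j ws"] ret[OF ws(2)] a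
        by (metis empty_set empty_subsetI insert_subset list.simps(15) set_drop_subset subset_trans)
      moreover have "j \<in> {0, 1, 2, 3, 4, 5, 6, 7, 8}"
        using j(1) ws(2) by auto
      ultimately have "j = 0 \<or> j = 6"
        using ws(2) ab by auto
      then show False
        using j(2) k ws(2) by auto
    qed
    show "?U \<noteq> ?V"
    proof
      assume "?U = ?V"
      \<comment> \<open>Unique decoding would identify the factor lists, which differ in the fourth
        entry.\<close>
      then have "prefix ?U ?V"
        by (simp only: prefix_order.refl)
      then have "prefix ?us ?vs"
        by (rule iffD1[OF prefix_concat_return_words_iff, rotated 2]) (use a b in simp_all)
      then show False using ab by simp
    qed
  qed
qed

theorem proposition4p5:
  fixes A :: "'a set" and X :: "(int \<Rightarrow> 'a) set"
  assumes "finite A"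
    and "subshift_of_finite_type A X"
    and "\<exists>Y. irreducible_component A X Y \<and> infinite Y"
  shows "\<not> injunctive A X"
proof -
  obtain n S where X: "X = sft A n S"
    using assms(2) unfolding subshift_of_finite_type_def sft_windows by blast
  obtain Q Y where Q: "irreducible_decomposition A X Q" "Y \<in> Q" and inf: "infinite Y"
    using assms(3) unfolding irreducible_component_def by blast
  have Y: "irreducible_subshift A Y" "infinite Y"
    using Q inf by (simp_all add: irreducible_decomposition_def)
  have "Y \<subseteq> NW A X"
    using Q unfolding irreducible_decomposition_def partition_on_def by blast
  also have "NW A X \<subseteq> X"
    by (simp add: NW_def)
  finally have YX: "Y \<subseteq> X" .
  obtain x i j y k l where w: "x \<in> Y" "y \<in> Y" "i < j" "k < l"
    "word x i n = word x j n" "word y k n = word x i n" "word y l n = word x i n"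
    "word x i (nat (j - i)) \<in> return_words (word x i n)"
    "word y k (nat (l - k)) \<in> return_words (word x i n)"
    "word x i (nat (j - i)) \<noteq> word y k (nat (l - k))"
    by (rule two_return_words[OF assms(1) Y(1,2)])
  define p a b where "p = word x i n" and "a = word x i (nat (j - i))" and "b = word y k (nat (l - k))"
  have xy: "x \<in> sft A n S" "y \<in> sft A n S"
    using w(1,2) YX X by auto
  have "a @ p = word x i (nat (j - i) + n)" "b @ p = word y k (nat (l - k) + n)"
    using word_append[of x i "nat (j - i)" n] word_append[of y k "nat (l - k)" n] w(3-7)
    by (simp_all add: a_def b_def p_def)
  then have "legal A n S (a @ p)" "legal A n S (b @ p)" "legal A n S p"
    using legal_word xy by (simp_all add: p_def)
  moreover have ab: "a \<in> return_words p" "b \<in> return_words p" "a \<noteq> b"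
    using w(8-10) by (simp_all add: a_def b_def p_def)
  \<comment> \<open>As \<open>p\<close> has the window length \<open>n\<close>, legality passes from
    \<open>a @ p\<close> and \<open>b @ p\<close> to all concatenations.\<close>
  ultimately have leg: "legal A n S (concat ws @ p)" if "set ws \<subseteq> {a, b}" for ws
    using that by (intro legal_concat_return_words) (auto simp: p_def)
  interpret marker_pair "concat [a, a] @ p" "concat [a, a, b, a, b, b, a, a] @ p"
    "concat [a, a, b, b, a, b, a, a] @ p" "3 * length a + 3 * length b"
    by (rule marker_pair_of_return_words[OF ab])
  show ?thesis
    unfolding X
    by (rule sft_not_injunctive)
      (auto simp: p_def simp del: concat.simps intro!: leg[unfolded p_def])
qed

end
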